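(* For every $\beta\in\mathbb{R}^{mK}$ and every $\rho\ge 0$, the exact Hessian $H=\nabla^2\mathcal{L}(\beta)$ and the sparsified Hessian $H_\rho=H_\rho(\beta)$ satisfy $$\|H-H_\rho\|\ \le\ 8mn\rho\,\big(\max_{k\in[K]}w_k\big)\Big(\frac1\tau+\frac1\eta\Big),$$ where $\|\cdot\|$ is the spectral norm.
   Context: Let $n,m,K\ge 1$ be integers, $[K]=\{1,\dots,K\}$, $\eta,\tau>0$, and let $\Delta_d=\{x\in\mathbb{R}_+^d:\sum_i x_i=1\}$. Let $\mu_k\in\Delta_m$ ($k\in[K]$), $C_k\in\mathbb{R}_+^{n\times m}$, $w_k>0$ with $\sum_{k=1}^K w_k=1$, and $\pi\in\Delta_n$. For $\beta=(\beta_1^\top,\dots,\beta_K^\top)^\top\in\mathbb{R}^{mK}$ with $\beta_k\in\mathbb{R}^m$ define: - $[\alpha_k(\beta_k)]_i=-\eta\log\big(\sum_{j=1}^m[\mu_k]_j\exp(([\beta_k]_j-[C_k]_{ij})/\eta)\big)$ for $i\in[n]$, and $\Phi(\beta)=\sum_{k=1}^K w_k\alpha_k(\beta_k)\in\mathbb{R}^n$; - $\mathcal{L}(\beta)=-\sum_{k=1}^K w_k\langle\beta_k,\mu_k\rangle+\tau\log\big(\sum_{i=1}^n\pi_i\exp(-[\Phi(\beta)]_i/\tau)\big)$; - $v=v(\beta)\in\Delta_n$, $v_i=\pi_i\exp(-[\Phi(\beta)]_i/\tau)\big/\sum_{l=1}^n\pi_l\exp(-[\Phi(\beta)]_l/\tau)$;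 - $P_k=P_k(\beta_k)\in\mathbb{R}^{n\times m}$, $[P_k]_{ij}=\dfrac{[\mu_k]_j\exp(([\beta_k]_j-[C_k]_{ij})/\eta)}{\sum_{l=1}^m[\mu_k]_l\exp(([\beta_k]_l-[C_k]_{il})/\eta)}$ (row-stochastic). Sparsification with threshold $\rho\ge 0$: fix $i^\star\in\arg\max_{i\in[n]}v_i$. Put $[P_{k,\rho}]_{i^\star j}=[P_k]_{i^\star j}$ for all $j$ and, for $i\neq i^\star$, $$[P_{k,\rho}]_{ij}=\frac{[P_k]_{ij}\,\mathbf{1}\{[P_k]_{ij}\ge\rho\}}{\sum_{l=1}^m[P_k]_{il}\,\mathbf{1}\{[P_k]_{il}\ge\rho\}}.$$ It is assumed that these denominators are nonzero (each row $i\ne i^\star$ of each $P_k$ has a nonzero entry $\ge\rho$), so $P_{k,\rho}$ is row-stochastic. Let $\gamma_{k,\rho}=P_{k,\rho}^\top v$. The sparsified Hessian $H_\rho$ has $m\times m$ blocks $$[H_\rho]_{kr}=\tfrac{w_kw_r}{\tau}\big(P_{k,\rho}^\top\mathrm{diag}(v)P_{r,\rho}-\gamma_{k,\rho}\gamma_{r,\rho}^\top\big)+\mathbf{1}\{k=r\}\,\tfrac{w_k}{\eta}\big(\mathrm{diag}(\gamma_{k,\rho})-P_{k,\rho}^\top\mathrm{diag}(v)P_{k,\rho}\big).$$ For $\rho=0$ one has $P_{k,0}=P_k$ and $H_0=H=\nabla^2\mathcal{L}(\beta)$; i.e. the blocks of $H$ are given by the same formula with $P_k$ in place of $P_{k,\rho}$.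 *)

theory Defs
  imports "HOL-Analysis.Analysis"
begin

definition prob_simplex :: "(real ^ 'd) set" where
  "prob_simplex = {x. (\<forall>i. 0 \<le> x $ i) \<and> (\<Sum>i\<in>UNIV. x $ i) = 1}"

definition diag_mat :: "real ^ 'd \<Rightarrow> real ^ 'd ^ 'd" where
  "diag_mat x = (\<chi> i j. if i = j then x $ i else 0)"

definition outer_prod :: "real ^ 'a \<Rightarrow> real ^ 'b \<Rightarrow> real ^ 'b ^ 'a" where
  "outer_prod x y = (\<chi> i j. x $ i * y $ j)"

text \<open>Vector of partial derivatives and its Jacobian. As with \<^const>\<open>frechet_derivative\<close>,
  the values are meaningful only where \<open>f\<close> (resp. its gradient) is differentiable.\<close>

definition gradient :: "(real ^ 'd \<Rightarrow> real) \<Rightarrow> real ^ 'd \<Rightarrow> real ^ 'd" where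
  "gradient f x = (\<chi> a. frechet_derivative f (at x) (axis a 1))"

definition hessian :: "(real ^ 'd \<Rightarrow> real) \<Rightarrow> real ^ 'd \<Rightarrow> real ^ 'd ^ 'd" where
  "hessian f x = jacobian (gradient f) (at x)"

text \<open>The spectral norm, as the operator norm induced by the Euclidean norm.\<close>

definition spectral_norm :: "real ^ 'a ^ 'b \<Rightarrow> real" where
  "spectral_norm A = onorm (\<lambda>x. A *v x)"

text \<open>
  The types \<open>'n\<close>, \<open>'m\<close>, \<open>'k\<close> play the roles of $[n]$, $[m]$, $[K]$. A vector
  $\beta \in R^{mK}$ is indexed by pairs \<open>(k, j)\<close>, block index first, and accordingly a
  $K \times K$ array of $m \times m$ blocks is a matrix indexed by such pairs.
\<close>

definition vec_block :: "real ^ ('k::finite \<times> 'm::finite) \<Rightarrow> 'k \<Rightarrow> real ^ 'm" where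
  "vec_block \<beta> k = (\<chi> j. \<beta> $ (k, j))"

definition from_blocks ::
  "('k \<Rightarrow> 'k \<Rightarrow> real ^ 'm ^ 'm) \<Rightarrow> real ^ ('k::finite \<times> 'm::finite) ^ ('k \<times> 'm)" where
  "from_blocks B = (\<chi> a b. B (fst a) (fst b) $ snd a $ snd b)"

text \<open>In the next two definitions \<open>\<mu>\<close>, \<open>C\<close>, \<open>b\<close> stand for
  single $\mu_k$, $C_k$, $\beta_k$; afterwards for the whole families.\<close>

definition alpha :: "real \<Rightarrow> real ^ 'm \<Rightarrow> real ^ 'm ^ 'n \<Rightarrow> real ^ 'm \<Rightarrow> real ^ 'n" where
  "alpha \<eta> \<mu> C b =
     (\<chi> i. - \<eta> * ln (\<Sum>j\<in>UNIV. \<mu> $ j * exp ((b $ j - C $ i $ j) / \<eta>)))"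

definition plan :: "real \<Rightarrow> real ^ 'm \<Rightarrow> real ^ 'm ^ 'n \<Rightarrow> real ^ 'm \<Rightarrow> real ^ 'm ^ 'n" where
  "plan \<eta> \<mu> C b =
     (\<chi> i j. \<mu> $ j * exp ((b $ j - C $ i $ j) / \<eta>)
             / (\<Sum>l\<in>UNIV. \<mu> $ l * exp ((b $ l - C $ i $ l) / \<eta>)))"

definition Phi ::
  "real \<Rightarrow> ('k \<Rightarrow> real) \<Rightarrow> ('k \<Rightarrow> real ^ 'm) \<Rightarrow> ('k \<Rightarrow> real ^ 'm ^ 'n)
     \<Rightarrow> real ^ ('k::finite \<times> 'm::finite) \<Rightarrow> real ^ 'n" where
  "Phi \<eta> w \<mu> C \<beta> = (\<Sum>k\<in>UNIV. w k *\<^sub>R alpha \<eta> (\<mu> k) (C k) (vec_block \<beta> k))"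

definition objective ::
  "real \<Rightarrow> real \<Rightarrow> ('k \<Rightarrow> real) \<Rightarrow> ('k \<Rightarrow> real ^ 'm) \<Rightarrow> ('k \<Rightarrow> real ^ 'm ^ 'n)
     \<Rightarrow> real ^ 'n \<Rightarrow> real ^ ('k::finite \<times> 'm::finite) \<Rightarrow> real" where
  "objective \<eta> \<tau> w \<mu> C p \<beta> =
     - (\<Sum>k\<in>UNIV. w k * (vec_block \<beta> k \<bullet> \<mu> k))
     + \<tau> * ln (\<Sum>i\<in>UNIV. p $ i * exp (- (Phi \<eta> w \<mu> C \<beta> $ i) / \<tau>))"

definition row_weights ::
  "real \<Rightarrow> real \<Rightarrow> ('k \<Rightarrow> real) \<Rightarrow> ('k \<Rightarrow> real ^ 'm) \<Rightarrow> ('k \<Rightarrow> real ^ 'm ^ 'n)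
     \<Rightarrow> real ^ 'n \<Rightarrow> real ^ ('k::finite \<times> 'm::finite) \<Rightarrow> real ^ 'n" where
  "row_weights \<eta> \<tau> w \<mu> C p \<beta> =
     (\<chi> i. p $ i * exp (- (Phi \<eta> w \<mu> C \<beta> $ i) / \<tau>)
           / (\<Sum>l\<in>UNIV. p $ l * exp (- (Phi \<eta> w \<mu> C \<beta> $ l) / \<tau>)))"

definition kept_mass :: "real \<Rightarrow> real ^ 'm ^ 'n \<Rightarrow> 'n \<Rightarrow> real" where
  "kept_mass \<rho> P i = (\<Sum>l\<in>UNIV. P $ i $ l * of_bool (P $ i $ l \<ge> \<rho>))"

text \<open>Entries below \<open>\<rho>\<close> are dropped and the row renormalised, except in row \<open>istar\<close>.\<close>

definition sparsify :: "real \<Rightarrow> 'n \<Rightarrow> real ^ 'm ^ 'n \<Rightarrow> real ^ 'm ^ 'n" where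
  "sparsify \<rho> istar P =
     (\<chi> i j. if i = istar then P $ i $ j
             else P $ i $ j * of_bool (P $ i $ j \<ge> \<rho>) / kept_mass \<rho> P i)"

definition hessian_block ::
  "real \<Rightarrow> real \<Rightarrow> ('k \<Rightarrow> real) \<Rightarrow> real ^ 'n \<Rightarrow> ('k \<Rightarrow> real ^ 'm ^ 'n)
     \<Rightarrow> 'k \<Rightarrow> 'k \<Rightarrow> real ^ 'm ^ 'm" where
  "hessian_block \<eta> \<tau> w v Q k r =
     (let \<gamma> = (\<lambda>s. transpose (Q s) *v v) in
        (w k * w r / \<tau>) *\<^sub>R
          (transpose (Q k) ** diag_mat v ** Q r - outer_prod (\<gamma> k) (\<gamma> r))
      + (of_bool (k = r) * (w k / \<eta>)) *\<^sub>R
          (diag_mat (\<gamma> k) - transpose (Q k) ** diag_mat v ** Q k))"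

definition sparsified_hessian ::
  "real \<Rightarrow> real \<Rightarrow> ('k \<Rightarrow> real) \<Rightarrow> ('k \<Rightarrow> real ^ 'm) \<Rightarrow> ('k \<Rightarrow> real ^ 'm ^ 'n)
     \<Rightarrow> real ^ 'n \<Rightarrow> real \<Rightarrow> 'n \<Rightarrow> real ^ ('k::finite \<times> 'm::finite)
     \<Rightarrow> real ^ ('k::finite \<times> 'm::finite) ^ ('k \<times> 'm)" where
  "sparsified_hessian \<eta> \<tau> w \<mu> C p \<rho> istar \<beta> =
     from_blocks (hessian_block \<eta> \<tau> w (row_weights \<eta> \<tau> w \<mu> C p \<beta>)
       (\<lambda>k. sparsify \<rho> istar (plan \<eta> (\<mu> k) (C k) (vec_block \<beta> k))))"

end

theory Submission
  imports Defs
begin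

text \<open>
  Read \<open>v\<close> as a law on rows \<open>i\<close> and row \<open>i\<close> of a row-stochastic \<open>Q k\<close> as a law on
  columns. Softmax has a covariance matrix as its derivative, so differentiating the objective
  twice, once through the softmax \<open>v\<close> and once through the softmaxes that form the plans,
  produces two covariances. Tested against \<open>y\<close> and \<open>x\<close>, with blocks \<open>y_k\<close> and \<open>x_k\<close>, the
  Hessian is
  \[ \frac1\tau\,\mathrm{Cov}_v\Bigl(\sum_k w_k Q_k y_k,\ \sum_k w_k Q_k x_k\Bigr)
     + \frac1\eta \sum_k w_k \sum_i v_i\, \mathrm{Cov}_{(Q_k)_i}(y_k, x_k) \]
  with \<open>Q\<close> the plans (\<open>inner_gradient_derivative\<close>, \<open>hessian_objective\<close>). The block formula has
  the same bilinear form for every \<open>Q\<close> (\<open>inner_hessian_blocks\<close>); the sparsified Hessian is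
  the case of sparsified plans, with the same \<open>v\<close>. Hence only the dependence of two covariances
  on \<open>Q\<close> matters.

  A row of a plan loses at most \<open>m\<close> entries smaller than \<open>\<rho>\<close>, so a mass of at most \<open>m\<rho>\<close>, and
  renormalising puts that mass back on the kept entries. In the 1-norm the row thus moves by at
  most \<open>2m\<rho>\<close> (\<open>sparsified_row\<close>). Both covariances are bilinear in quantities that move by at
  most this 1-norm times a Euclidean norm. The sum of \<open>w_k\<close> times the norm of \<open>x_k\<close> is at most
  the square root of \<open>max w\<close> times the norm of \<open>x\<close>, because \<open>w\<close> sums to 1, so that the
  first covariance, which contains such a factor for each argument, scales with \<open>max w\<close> only.
  For unit vectors \<open>y\<close> and \<open>x\<close>, each of the two terms changes by at most \<open>8m\<rho> max w\<close>,
  before the division by \<open>\<tau>\<close> or \<open>\<eta>\<close> (\<open>cov_form_perturb\<close>). A factor \<open>n \<ge> 1\<close> may be added freely.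
\<close>

(* Transposes stay visible, so that they can be moved across inner products. *)
declare transpose_matrix_vector [simp del]

section \<open>Softmax and its derivative\<close>

definition softmax :: "real ^ 'd \<Rightarrow> real ^ 'd \<Rightarrow> real ^ 'd" where
  "softmax c u = (\<chi> i. c $ i * exp (u $ i) / (\<Sum>l\<in>UNIV. c $ l * exp (u $ l)))"

lemma partition_pos:
  assumes "c \<in> prob_simplex"
  shows "(\<Sum>l\<in>UNIV. c $ l * exp (u $ l :: real)) > 0"
proof -
  have nn: "\<And>i. 0 \<le> c $ i" and s: "(\<Sum>i\<in>UNIV. c $ i) = 1"
    using assms by (auto simp: prob_simplex_def)
  obtain i where "c $ i \<noteq> 0"
    using s by (metis sum.neutral zero_neq_one)
  then have "c $ i > 0" using nn[of i] by linarith
  then show ?thesis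
    by (intro sum_pos2[of _ i]) (use nn \<open>c $ i > 0\<close> in auto)
qed

lemma softmax_in_prob_simplex:
  assumes "c \<in> prob_simplex"
  shows "softmax c u \<in> prob_simplex"
  using partition_pos[OF assms, of u] assms
  by (auto simp: prob_simplex_def softmax_def sum_divide_distrib[symmetric] less_imp_le)

lemmas has_derivative_nth = bounded_linear.has_derivative[OF bounded_linear_vec_nth]

lemma has_derivative_vecI:
  fixes f :: "'a::real_normed_vector \<Rightarrow> real ^ 'd"
  assumes "\<And>i. ((\<lambda>x. f x $ i) has_derivative (\<lambda>h. f' h $ i)) (at x within S)"
  shows "(f has_derivative f') (at x within S)"
  using assms
  by (subst has_derivative_componentwise_within) (auto simp: Basis_vec_def inner_axis)

lemma has_derivative_ln_partition:
  fixes u :: "'a::real_normed_vector \<Rightarrow> real ^ 'd"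
  assumes c: "c \<in> prob_simplex" and u: "(u has_derivative u') (at x)"
  shows "((\<lambda>x. ln (\<Sum>i\<in>UNIV. c $ i * exp (u x $ i))) has_derivative
           (\<lambda>h. softmax c (u x) \<bullet> u' h)) (at x)"
  using partition_pos[OF c, of "u x"]
  by (auto intro!: derivative_eq_intros ext u[THEN has_derivative_nth]
        simp: softmax_def inner_vec_def sum_distrib_left sum_distrib_right divide_simps mult_ac)

text \<open>The covariance matrix of the law \<open>q\<close> applied to \<open>g\<close>: the vector that represents
  \<open>f \<mapsto> Cov(f, g)\<close>, see \<open>inner_centred\<close> below.\<close>

definition centred :: "real ^ 'd \<Rightarrow> real ^ 'd \<Rightarrow> real ^ 'd" where
  "centred q g = (\<chi> i. q $ i * (g $ i - q \<bullet> g))"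

text \<open>Writing a softmax entry as one exponential, of its logit minus the logarithm of
  the normaliser, makes the derivative of that logarithm, the mean of \<open>u'\<close>, the centring
  term.\<close>

lemma has_derivative_softmax:
  fixes u :: "'a::real_normed_vector \<Rightarrow> real ^ 'd"
  assumes c: "c \<in> prob_simplex" and u: "(u has_derivative u') (at x)"
  shows "((\<lambda>x. softmax c (u x)) has_derivative (\<lambda>h. centred (softmax c (u x)) (u' h))) (at x)"
proof (rule has_derivative_vecI)
  fix i
  define L where "L = (\<lambda>x. ln (\<Sum>l\<in>UNIV. c $ l * exp (u x $ l)))"
  have eq: "softmax c (u x) $ i = c $ i * exp (u x $ i - L x)" for x
    using partition_pos[OF c, of "u x"] by (simp add: softmax_def exp_diff L_def)
  have dL: "(L has_derivative (\<lambda>h. softmax c (u x) \<bullet> u' h)) (at x)"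
    unfolding L_def by (rule has_derivative_ln_partition[OF c u])
  show "((\<lambda>x. softmax c (u x) $ i) has_derivative
      (\<lambda>h. centred (softmax c (u x)) (u' h) $ i)) (at x)"
    unfolding eq centred_def
    by (auto intro!: derivative_eq_intros dL u[THEN has_derivative_nth] simp: eq algebra_simps)
qed

section \<open>Covariance\<close>

definition weighted_cov :: "real ^ 'd \<Rightarrow> real ^ 'd \<Rightarrow> real ^ 'd \<Rightarrow> real" where
  "weighted_cov q f g = (\<Sum>i\<in>UNIV. q $ i * (f $ i * g $ i)) - (q \<bullet> f) * (q \<bullet> g)"

lemma centred_scaleR: "centred q (c *\<^sub>R g) = c *\<^sub>R centred q g"
  by (simp add: centred_def vec_eq_iff algebra_simps)

lemma inner_centred: "f \<bullet> centred q g = weighted_cov q f g"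
  by (simp add: weighted_cov_def centred_def inner_vec_def[of f] inner_vec_def[of q f]
      right_diff_distrib sum_subtractf sum_distrib_left mult_ac)

lemma weighted_cov_diff_left:
  "weighted_cov q (f - f') g = weighted_cov q f g - weighted_cov q f' g"
  by (simp add: weighted_cov_def algebra_simps sum_subtractf inner_diff_right)

lemma weighted_cov_diff_right:
  "weighted_cov q f (g - g') = weighted_cov q f g - weighted_cov q f g'"
  by (simp add: weighted_cov_def algebra_simps sum_subtractf inner_diff_right)

lemma weighted_cov_scaleR_sum:
  "weighted_cov q (\<Sum>k\<in>A. c k *\<^sub>R f k) (\<Sum>r\<in>B. d r *\<^sub>R g r)
    = (\<Sum>k\<in>A. \<Sum>r\<in>B. c k * d r * weighted_cov q (f k) (g r))"
proof -
  have "(\<Sum>i\<in>UNIV. q $ i * ((\<Sum>k\<in>A. c k * f k $ i) * (\<Sum>r\<in>B. d r * g r $ i)))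
      = (\<Sum>i\<in>UNIV. \<Sum>k\<in>A. \<Sum>r\<in>B. c k * d r * (q $ i * (f k $ i * g r $ i)))"
    unfolding sum_product unfolding sum_distrib_left by (simp add: mult_ac)
  also have "\<dots> = (\<Sum>k\<in>A. \<Sum>i\<in>UNIV. \<Sum>r\<in>B. c k * d r * (q $ i * (f k $ i * g r $ i)))"
    by (rule sum.swap)
  also have "\<dots> = (\<Sum>k\<in>A. \<Sum>r\<in>B. \<Sum>i\<in>UNIV. c k * d r * (q $ i * (f k $ i * g r $ i)))"
    by (intro sum.cong refl sum.swap)
  finally have "(\<Sum>i\<in>UNIV. q $ i * ((\<Sum>k\<in>A. c k * f k $ i) * (\<Sum>r\<in>B. d r * g r $ i)))
      = (\<Sum>k\<in>A. \<Sum>r\<in>B. c k * d r * (\<Sum>i\<in>UNIV. q $ i * (f k $ i * g r $ i)))"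
    by (simp add: sum_distrib_left)
  moreover have "(\<Sum>k\<in>A. c k * (q \<bullet> f k)) * (\<Sum>r\<in>B. d r * (q \<bullet> g r))
      = (\<Sum>k\<in>A. \<Sum>r\<in>B. c k * d r * ((q \<bullet> f k) * (q \<bullet> g r)))"
    unfolding sum_product by (simp add: mult_ac)
  ultimately show ?thesis
    by (simp add: weighted_cov_def inner_sum_right right_diff_distrib sum_subtractf)
qed

lemma abs_weighted_mean_le:
  assumes "q \<in> prob_simplex" and "\<And>i. \<bar>f i\<bar> \<le> F"
  shows "\<bar>\<Sum>i\<in>UNIV. q $ i * f i\<bar> \<le> F"
proof -
  have "\<bar>\<Sum>i\<in>UNIV. q $ i * f i\<bar> \<le> (\<Sum>i\<in>UNIV. \<bar>q $ i * f i\<bar>)" by (rule sum_abs)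
  also have "\<dots> \<le> (\<Sum>i\<in>UNIV. q $ i * F)"
    using assms by (intro sum_mono) (auto simp: abs_mult prob_simplex_def intro!: mult_left_mono)
  also have "\<dots> = F"
    using assms(1) by (simp add: sum_distrib_right[symmetric] prob_simplex_def)
  finally show ?thesis .
qed

lemma abs_weighted_cov_le:
  assumes q: "q \<in> prob_simplex"
    and f: "\<And>i. \<bar>f $ i\<bar> \<le> F" and g: "\<And>i. \<bar>g $ i\<bar> \<le> G"
  shows "\<bar>weighted_cov q f g\<bar> \<le> 2 * F * G"
proof -
  have F: "0 \<le> F" using f[of undefined] by linarith
  have "\<bar>\<Sum>i\<in>UNIV. q $ i * (f $ i * g $ i)\<bar> \<le> F * G"
    by (rule abs_weighted_mean_le[OF q]) (auto simp: abs_mult intro!: mult_mono f g F)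
  moreover have "\<bar>(q \<bullet> f) * (q \<bullet> g)\<bar> \<le> F * G"
    using abs_weighted_mean_le[OF q f] abs_weighted_mean_le[OF q g] F
    by (auto simp: inner_vec_def abs_mult intro!: mult_mono)
  ultimately show ?thesis unfolding weighted_cov_def by linarith
qed

definition l1_norm :: "real ^ 'd \<Rightarrow> real" where
  "l1_norm q = (\<Sum>j\<in>UNIV. \<bar>q $ j\<bar>)"

lemma l1_norm_nonneg: "0 \<le> l1_norm q"
  by (simp add: l1_norm_def sum_nonneg)

lemma l1_norm_prob_simplex: "q \<in> prob_simplex \<Longrightarrow> l1_norm q = 1"
  by (simp add: l1_norm_def prob_simplex_def)

lemma abs_sum_le_l1_norm:
  assumes "\<And>j. \<bar>f j\<bar> \<le> F"
  shows "\<bar>\<Sum>j\<in>UNIV. q $ j * f j\<bar> \<le> l1_norm q * F"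
proof -
  have "\<bar>\<Sum>i\<in>UNIV. q $ i * f i\<bar> \<le> (\<Sum>i\<in>UNIV. \<bar>q $ i * f i\<bar>)" by (rule sum_abs)
  also have "\<dots> \<le> (\<Sum>i\<in>UNIV. \<bar>q $ i\<bar> * F)"
    using assms by (intro sum_mono) (auto simp: abs_mult intro!: mult_left_mono)
  finally show ?thesis by (simp add: l1_norm_def sum_distrib_right)
qed

lemma abs_inner_le_l1_norm: "\<bar>q \<bullet> x\<bar> \<le> l1_norm q * norm (x :: real ^ 'd)"
  using abs_sum_le_l1_norm[of "\<lambda>j. x $ j" "norm x" q] component_le_norm_cart[of x]
  by (simp add: inner_vec_def)

text \<open>The difference splits into three terms, each of which carries one factor linear in
  \<open>q - q'\<close>. The 1-norm is the right measure of that factor: entries of vectors are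
  bounded by Euclidean norms, whatever the dimension.\<close>

lemma weighted_cov_perturb:
  assumes q: "q \<in> prob_simplex" and q': "q' \<in> prob_simplex"
  shows "\<bar>weighted_cov q y x - weighted_cov q' y x\<bar> \<le> 3 * l1_norm (q - q') * (norm y * norm x)"
proof -
  define D where "D = l1_norm (q - q')"
  have D: "0 \<le> D" by (simp add: D_def l1_norm_nonneg)
  have "weighted_cov q y x - weighted_cov q' y x
      = (\<Sum>j\<in>UNIV. (q - q') $ j * (y $ j * x $ j))
        - ((q - q') \<bullet> y) * (q \<bullet> x) - (q' \<bullet> y) * ((q - q') \<bullet> x)"
    by (simp add: weighted_cov_def inner_diff_left sum_subtractf algebra_simps)
  moreover have "\<bar>\<Sum>j\<in>UNIV. (q - q') $ j * (y $ j * x $ j)\<bar> \<le> D * (norm y * norm x)"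
    unfolding D_def
    by (rule abs_sum_le_l1_norm) (auto simp: abs_mult intro!: mult_mono component_le_norm_cart)
  moreover have "\<bar>((q - q') \<bullet> y) * (q \<bullet> x)\<bar> \<le> (D * norm y) * (1 * norm x)"
    unfolding abs_mult D_def l1_norm_prob_simplex[OF q, symmetric]
    by (intro mult_mono abs_inner_le_l1_norm) (auto simp: l1_norm_nonneg)
  moreover have "\<bar>(q' \<bullet> y) * ((q - q') \<bullet> x)\<bar> \<le> (1 * norm y) * (D * norm x)"
    unfolding abs_mult D_def l1_norm_prob_simplex[OF q', symmetric]
    by (intro mult_mono abs_inner_le_l1_norm) (auto simp: l1_norm_nonneg)
  ultimately show ?thesis unfolding D_def[symmetric] by (simp add: mult_ac)
qed

section \<open>Hessian as a sum of covariances\<close>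

definition mixed_rows ::
  "('k::finite \<Rightarrow> real) \<Rightarrow> ('k \<Rightarrow> real ^ 'm::finite ^ 'n) \<Rightarrow> real ^ ('k \<times> 'm) \<Rightarrow> real ^ 'n" where
  "mixed_rows w Q x = (\<Sum>k\<in>UNIV. w k *\<^sub>R (Q k *v vec_block x k))"

text \<open>Shaped like the law of total covariance: a covariance of row means plus an average of
  covariances within rows, each divided by the temperature of the softmax that it comes from.\<close>

definition cov_form ::
  "real \<Rightarrow> real \<Rightarrow> ('k \<Rightarrow> real) \<Rightarrow> real ^ 'n \<Rightarrow> ('k \<Rightarrow> real ^ 'm ^ 'n)
     \<Rightarrow> real ^ ('k::finite \<times> 'm::finite) \<Rightarrow> real ^ ('k \<times> 'm) \<Rightarrow> real" where
  "cov_form \<eta> \<tau> w v Q y x =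
     weighted_cov v (mixed_rows w Q y) (mixed_rows w Q x) / \<tau>
     + (\<Sum>k\<in>UNIV. w k * (\<Sum>i\<in>UNIV. v $ i * weighted_cov (Q k $ i) (vec_block y k) (vec_block x k)))
         / \<eta>"

lemma sum_UNIV_blocks:
  "(\<Sum>a\<in>UNIV. f a) = (\<Sum>k\<in>UNIV. \<Sum>j\<in>UNIV. f (k::'k::finite, j::'m::finite))"
  by (simp add: sum.cartesian_product flip: UNIV_Times_UNIV)

lemma inner_blocks: "y \<bullet> x = (\<Sum>k\<in>UNIV. vec_block y k \<bullet> vec_block x k)"
  by (simp add: inner_vec_def vec_block_def sum_UNIV_blocks)

text \<open>Reduces matrices over pair indices to their blocks, where the matrix calculus of a
  single plan applies.\<close>

lemma inner_from_blocks:
  "y \<bullet> (from_blocks B *v x) = (\<Sum>k\<in>UNIV. \<Sum>r\<in>UNIV. vec_block y k \<bullet> (B k r *v vec_block x r))"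
proof -
  have "vec_block (from_blocks B *v x) k = (\<Sum>r\<in>UNIV. B k r *v vec_block x r)" for k
    by (simp add: vec_eq_iff vec_block_def matrix_vector_mult_def from_blocks_def sum_UNIV_blocks)
  then show ?thesis by (simp add: inner_blocks inner_sum_right)
qed

lemma inner_transpose_mult: "y \<bullet> (transpose A *v x) = (A *v y) \<bullet> (x :: real ^ 'n)"
  by (metis dot_lmul_matrix inner_commute transpose_matrix_vector)

lemma transpose_mult_inner: "(transpose A *v x) \<bullet> y = (x :: real ^ 'n) \<bullet> (A *v y)"
  using inner_transpose_mult[of y A x] by (simp add: inner_commute)

lemma matrix_vector_nth: "(A *v x) $ i = A $ i \<bullet> (x :: real ^ 'n)"
  by (simp add: matrix_vector_mult_def inner_vec_def)

lemma inner_diag_mat: "y \<bullet> (diag_mat g *v x) = (\<Sum>i\<in>UNIV. g $ i * (y $ i * x $ i))"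
  by (simp add: inner_vec_def matrix_vector_mult_def diag_mat_def if_distrib if_distribR
      cong: if_cong) (simp add: mult_ac)

lemma inner_outer_prod: "y \<bullet> (outer_prod f g *v x) = (f \<bullet> y) * (g \<bullet> x)"
proof -
  have "outer_prod f g *v x = (g \<bullet> x) *\<^sub>R f"
    by (simp add: vec_eq_iff inner_vec_def matrix_vector_mult_def outer_prod_def sum_distrib_left
        mult_ac)
  then show ?thesis by (simp add: inner_commute)
qed

lemma inner_diag_pushforward:
  "y \<bullet> (diag_mat (transpose Q *v v) *v x)
    = (\<Sum>i\<in>UNIV. v $ i * (\<Sum>j\<in>UNIV. Q $ i $ j * (y $ j * x $ j)))"
proof -
  have "y \<bullet> (diag_mat (transpose Q *v v) *v x)
      = (\<Sum>j\<in>UNIV. \<Sum>i\<in>UNIV. v $ i * (Q $ i $ j * (y $ j * x $ j)))"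
    unfolding inner_diag_mat
    by (simp add: matrix_vector_mult_def transpose_def sum_distrib_left
        sum_distrib_right mult_ac)
  also have "\<dots> = (\<Sum>i\<in>UNIV. \<Sum>j\<in>UNIV. v $ i * (Q $ i $ j * (y $ j * x $ j)))"
    by (rule sum.swap)
  finally show ?thesis by (simp add: sum_distrib_left)
qed

lemma inner_sandwich:
  "y \<bullet> ((transpose Q ** diag_mat v ** R) *v x) = (\<Sum>i\<in>UNIV. v $ i * ((Q *v y) $ i * (R *v x) $ i))"
  by (simp add: matrix_vector_mul_assoc[symmetric] inner_transpose_mult inner_diag_mat)

lemma inner_hessian_block:
  "y \<bullet> (hessian_block \<eta> \<tau> w v Q k r *v x)
    = w k * w r * weighted_cov v (Q k *v y) (Q r *v x) / \<tau>
      + of_bool (k = r) * (w k * (\<Sum>i\<in>UNIV. v $ i * weighted_cov (Q k $ i) y x) / \<eta>)"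
proof -
  have "y \<bullet> (hessian_block \<eta> \<tau> w v Q k r *v x)
      = w k * w r / \<tau> *
          (y \<bullet> ((transpose (Q k) ** diag_mat v ** Q r) *v x)
           - y \<bullet> (outer_prod (transpose (Q k) *v v) (transpose (Q r) *v v) *v x))
        + of_bool (k = r) * (w k / \<eta>) *
          (y \<bullet> (diag_mat (transpose (Q k) *v v) *v x)
           - y \<bullet> ((transpose (Q k) ** diag_mat v ** Q k) *v x))"
    by (simp add: hessian_block_def Let_def matrix_vector_mult_add_rdistrib
        matrix_vector_mult_diff_rdistrib scaleR_matrix_vector_assoc[symmetric]
        inner_add_right inner_diff_right)
  also have "y \<bullet> ((transpose (Q k) ** diag_mat v ** Q r) *v x)
           - y \<bullet> (outer_prod (transpose (Q k) *v v) (transpose (Q r) *v v) *v x)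
      = weighted_cov v (Q k *v y) (Q r *v x)"
    by (simp add: inner_sandwich inner_outer_prod weighted_cov_def transpose_mult_inner)
  also have "y \<bullet> (diag_mat (transpose (Q k) *v v) *v x)
           - y \<bullet> ((transpose (Q k) ** diag_mat v ** Q k) *v x)
      = (\<Sum>i\<in>UNIV. v $ i * weighted_cov (Q k $ i) y x)"
    by (simp add: inner_sandwich inner_diag_pushforward weighted_cov_def matrix_vector_nth
        right_diff_distrib sum_subtractf)
  finally show ?thesis by simp
qed

text \<open>Summing the blocks pulls the weights into the first covariance by bilinearity; the
  diagonal blocks contribute the covariances within rows. Since \<open>Q\<close> is arbitrary, this covers
  exact and sparsified plans alike.\<close>

lemma inner_hessian_blocks:
  "y \<bullet> (from_blocks (hessian_block \<eta> \<tau> w v Q) *v x) = cov_form \<eta> \<tau> w v Q y x"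
  by (simp add: inner_from_blocks inner_hessian_block cov_form_def mixed_rows_def
      weighted_cov_scaleR_sum sum.distrib sum_divide_distrib)
    (simp add: of_bool_def if_distrib if_distribR cong: if_cong)

section \<open>The exact Hessian\<close>

lemma gradient_eqI:
  assumes "\<And>x. (f has_derivative (\<lambda>h. G x \<bullet> h)) (at x)"
  shows "gradient f = G"
proof
  fix x
  have "frechet_derivative f (at x) = (\<lambda>h. G x \<bullet> h)"
    using assms by (metis frechet_derivative_at)
  then show "gradient f x = G x"
    by (simp add: gradient_def vec_eq_iff inner_axis)
qed

text \<open>The derivative of \<open>f\<close> must be known at every point, since \<open>G\<close> has to agree with
  the gradient near \<open>x\<close> before it can be differentiated.\<close>

lemma hessian_mult_vector:
  assumes "\<And>x. (f has_derivative (\<lambda>h. G x \<bullet> h)) (at x)"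
    and D: "(G has_derivative D) (at x)"
  shows "hessian f x *v h = D h"
proof -
  have "hessian f x = matrix D"
    by (simp only: hessian_def gradient_eqI[OF assms(1)] jacobian_def
        frechet_derivative_at[OF D, symmetric])
  then show ?thesis
    using matrix_vector_mul(2)[OF has_derivative_linear[OF D]] by metis
qed

text \<open>Both layers of the objective are softmaxes: the logits of a plan row are affine in \<open>\<beta>\<close>,
  those of the row weights are \<open>-\<Phi>/\<tau>\<close>.\<close>

lemma plan_row: "plan \<eta> \<mu> C b $ i = softmax \<mu> ((1 / \<eta>) *\<^sub>R (b - C $ i))"
  by (simp add: plan_def softmax_def vec_eq_iff)

lemma row_weights_softmax:
  "row_weights \<eta> \<tau> w \<mu> C p \<beta> = softmax p ((- 1 / \<tau>) *\<^sub>R Phi \<eta> w \<mu> C \<beta>)"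
  by (simp add: row_weights_def softmax_def vec_eq_iff)

lemma vec_block_nth: "vec_block x k $ j = x $ (k, j)"
  by (simp add: vec_block_def)

lemma linear_vec_block: "linear (\<lambda>x. vec_block x k)"
  by (rule linearI) (simp_all add: vec_block_def vec_eq_iff)

lemmas has_derivative_vec_block =
  linear_imp_has_derivative[OF linear_vec_block]

context
  fixes \<eta> \<tau> :: real
    and w :: "'k::finite \<Rightarrow> real"
    and \<mu> :: "'k \<Rightarrow> real ^ 'm::finite"
    and C :: "'k \<Rightarrow> real ^ 'm ^ 'n::finite"
    and p :: "real ^ 'n"
  assumes \<eta>: "\<eta> > 0" and \<tau>: "\<tau> > 0"
    and \<mu>: "\<And>k. \<mu> k \<in> prob_simplex" and p: "p \<in> prob_simplex"
begin

abbreviation (input) plans where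
  "plans \<beta> \<equiv> \<lambda>k. plan \<eta> (\<mu> k) (C k) (vec_block \<beta> k)"

abbreviation (input) weights where
  "weights \<beta> \<equiv> row_weights \<eta> \<tau> w \<mu> C p \<beta>"

lemma has_derivative_logits:
  "((\<lambda>\<beta>. (1 / \<eta>) *\<^sub>R (vec_block \<beta> k - C k $ i)) has_derivative
      (\<lambda>h. (1 / \<eta>) *\<^sub>R vec_block h k)) (at \<beta>)"
  by (auto intro!: derivative_eq_intros has_derivative_vec_block)

text \<open>Each \<open>\<alpha>\<close> is a scaled log-partition function, whose gradient is the softmax, here a row
  of the plan; the two factors \<open>\<eta>\<close> cancel.\<close>

lemma has_derivative_Phi:
  "(Phi \<eta> w \<mu> C has_derivative (\<lambda>h. - mixed_rows w (plans \<beta>) h)) (at \<beta>)"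
proof -
  have "((\<lambda>\<beta>. alpha \<eta> (\<mu> k) (C k) (vec_block \<beta> k) $ i) has_derivative
          (\<lambda>h. - (plans \<beta> k *v vec_block h k) $ i)) (at \<beta>)" for k i
    using has_derivative_mult_right[OF has_derivative_ln_partition[OF \<mu> has_derivative_logits],
        where x = "- \<eta>"] \<eta>
    by (simp add: alpha_def matrix_vector_nth plan_row)
  then show ?thesis
    by (intro has_derivative_vecI)
      (auto simp: Phi_def mixed_rows_def sum_negf[symmetric]
        intro!: has_derivative_sum derivative_eq_intros)
qed

lemma has_derivative_row_logits:
  "((\<lambda>\<beta>. (- 1 / \<tau>) *\<^sub>R Phi \<eta> w \<mu> C \<beta>) has_derivative
      (\<lambda>h. (1 / \<tau>) *\<^sub>R mixed_rows w (plans \<beta>) h)) (at \<beta>)"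
  by (auto intro!: derivative_eq_intros has_derivative_Phi)

definition objective_gradient :: "real ^ ('k \<times> 'm) \<Rightarrow> real ^ ('k \<times> 'm)" where
  "objective_gradient \<beta> = (\<chi> a.
     w (fst a) * ((\<Sum>i\<in>UNIV. weights \<beta> $ i * plans \<beta> (fst a) $ i $ snd a) - \<mu> (fst a) $ snd a))"

text \<open>The product rule for \<open>v_i P_ij\<close> in the gradient, with each softmax factor
  differentiated by centring its logits' increment.\<close>

definition gradient_derivative ::
  "real ^ ('k \<times> 'm) \<Rightarrow> real ^ ('k \<times> 'm) \<Rightarrow> real ^ ('k \<times> 'm)" where
  "gradient_derivative \<beta> h = (\<chi> a. w (fst a) * (\<Sum>i\<in>UNIV.
       centred (weights \<beta>) ((1 / \<tau>) *\<^sub>R mixed_rows w (plans \<beta>) h) $ i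
         * plans \<beta> (fst a) $ i $ snd a
     + weights \<beta> $ i
         * centred (plans \<beta> (fst a) $ i) ((1 / \<eta>) *\<^sub>R vec_block h (fst a)) $ snd a))"

lemma has_derivative_objective:
  "(objective \<eta> \<tau> w \<mu> C p has_derivative (\<lambda>h. objective_gradient \<beta> \<bullet> h)) (at \<beta>)"
proof -
  have ln: "((\<lambda>\<beta>. ln (\<Sum>i\<in>UNIV. p $ i * exp (((- 1 / \<tau>) *\<^sub>R Phi \<eta> w \<mu> C \<beta>) $ i))) has_derivative
      (\<lambda>h. weights \<beta> \<bullet> ((1 / \<tau>) *\<^sub>R mixed_rows w (plans \<beta>) h))) (at \<beta>)"
    unfolding row_weights_softmax
    by (rule has_derivative_ln_partition[OF p has_derivative_row_logits])
  have "objective \<eta> \<tau> w \<mu> C p = (\<lambda>\<beta>. - (\<Sum>k\<in>UNIV. w k * (vec_block \<beta> k \<bullet> \<mu> k))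
      + \<tau> * ln (\<Sum>i\<in>UNIV. p $ i * exp (((- 1 / \<tau>) *\<^sub>R Phi \<eta> w \<mu> C \<beta>) $ i)))"
    by (simp add: objective_def fun_eq_iff)
  then have "(objective \<eta> \<tau> w \<mu> C p has_derivative
      (\<lambda>h. - (\<Sum>k\<in>UNIV. w k * (vec_block h k \<bullet> \<mu> k))
        + \<tau> * (weights \<beta> \<bullet> ((1 / \<tau>) *\<^sub>R mixed_rows w (plans \<beta>) h)))) (at \<beta>)"
    by (simp only:) (intro has_derivative_add has_derivative_minus has_derivative_sum
        has_derivative_mult_right has_derivative_inner_left has_derivative_vec_block ln)
  moreover have "- (\<Sum>k\<in>UNIV. w k * (vec_block h k \<bullet> \<mu> k))
        + \<tau> * (weights \<beta> \<bullet> ((1 / \<tau>) *\<^sub>R mixed_rows w (plans \<beta>) h)) = objective_gradient \<beta> \<bullet> h"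
    for h
  proof -
    have "vec_block (objective_gradient \<beta>) k
        = w k *\<^sub>R (transpose (plans \<beta> k) *v weights \<beta> - \<mu> k)" for k
      by (simp add: vec_eq_iff vec_block_def objective_gradient_def matrix_vector_mult_def
          transpose_def mult_ac)
    then show ?thesis
      using \<tau> by (simp add: inner_blocks mixed_rows_def inner_sum_right inner_diff_left
          inner_commute[of "vec_block h _"] transpose_mult_inner right_diff_distrib sum_subtractf)
  qed
  ultimately show ?thesis by simp
qed

lemma has_derivative_objective_gradient:
  "(objective_gradient has_derivative gradient_derivative \<beta>) (at \<beta>)"
proof (rule has_derivative_vecI)
  fix a
  have v: "((\<lambda>\<beta>. weights \<beta> $ i) has_derivative
      (\<lambda>h. centred (weights \<beta>) ((1 / \<tau>) *\<^sub>R mixed_rows w (plans \<beta>) h) $ i)) (at \<beta>)" for i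
    unfolding row_weights_softmax
    by (rule has_derivative_nth[OF has_derivative_softmax[OF p has_derivative_row_logits]])
  have P: "((\<lambda>\<beta>. plans \<beta> k $ i $ j) has_derivative
      (\<lambda>h. centred (plans \<beta> k $ i) ((1 / \<eta>) *\<^sub>R vec_block h k) $ j)) (at \<beta>)" for k i j
    unfolding plan_row
    by (rule has_derivative_nth[OF has_derivative_softmax[OF \<mu> has_derivative_logits]])
  show "((\<lambda>\<beta>. objective_gradient \<beta> $ a) has_derivative
      (\<lambda>h. gradient_derivative \<beta> h $ a)) (at \<beta>)"
    unfolding objective_gradient_def gradient_derivative_def
    by (auto intro!: derivative_eq_intros v P simp: algebra_simps)
qed

text \<open>Pairing a centred vector with a test vector gives a covariance. In the first layer the
  transposed plan moves onto \<open>y_k\<close>, and the remaining sum over \<open>k\<close> mixes these into the left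
  argument of \<open>Cov_v\<close>.\<close>

lemma inner_gradient_derivative:
  "y \<bullet> gradient_derivative \<beta> h = cov_form \<eta> \<tau> w (weights \<beta>) (plans \<beta>) y h"
proof -
  have blk: "vec_block (gradient_derivative \<beta> h) k = w k *\<^sub>R
      ((1 / \<tau>) *\<^sub>R (transpose (plans \<beta> k) *v centred (weights \<beta>) (mixed_rows w (plans \<beta>) h))
       + (1 / \<eta>) *\<^sub>R (\<Sum>i\<in>UNIV. weights \<beta> $ i *\<^sub>R centred (plans \<beta> k $ i) (vec_block h k)))" for k
    by (simp add: vec_eq_iff vec_block_nth gradient_derivative_def matrix_vector_mult_def
        transpose_def sum.distrib sum_divide_distrib centred_scaleR mult_ac)
  have "y \<bullet> gradient_derivative \<beta> h = (\<Sum>k\<in>UNIV. w k *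
      (weighted_cov (weights \<beta>) (plans \<beta> k *v vec_block y k) (mixed_rows w (plans \<beta>) h) / \<tau>
       + (\<Sum>i\<in>UNIV. weights \<beta> $ i * weighted_cov (plans \<beta> k $ i) (vec_block y k) (vec_block h k)) / \<eta>))"
    by (simp add: inner_blocks blk inner_add_right inner_transpose_mult inner_centred inner_sum_right)
  also have "\<dots> = cov_form \<eta> \<tau> w (weights \<beta>) (plans \<beta>) y h"
    (* The right argument is fixed here, hence a sum over a single index. *)
    using weighted_cov_scaleR_sum[of "weights \<beta>" w "\<lambda>k. plans \<beta> k *v vec_block y k" UNIV
        "\<lambda>_. 1" "\<lambda>_. mixed_rows w (plans \<beta>) h" "{()}"]
    by (simp add: cov_form_def mixed_rows_def distrib_left sum.distrib sum_divide_distrib[symmetric])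
  finally show ?thesis .
qed

text \<open>A matrix is determined by its bilinear form, so no entrywise comparison is needed.\<close>

lemma hessian_objective:
  "hessian (objective \<eta> \<tau> w \<mu> C p) \<beta>
    = from_blocks (hessian_block \<eta> \<tau> w (weights \<beta>) (plans \<beta>))"
proof -
  have "hessian (objective \<eta> \<tau> w \<mu> C p) \<beta> *v h
      = from_blocks (hessian_block \<eta> \<tau> w (weights \<beta>) (plans \<beta>)) *v h" for h
    unfolding hessian_mult_vector[OF has_derivative_objective has_derivative_objective_gradient]
    by (subst vector_eq_ldot[symmetric]) (simp add: inner_gradient_derivative inner_hessian_blocks)
  then show ?thesis by (simp add: matrix_eq)
qed

end

section \<open>Perturbation of the covariance form\<close>

text \<open>If the kept mass is \<open>\<kappa>\<close>, the dropped entries account for a 1-norm of \<open>1 - \<kappa>\<close>, and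
  scaling the kept ones by \<open>1/\<kappa>\<close> for another \<open>1 - \<kappa>\<close>. At most all \<open>m\<close> entries are dropped,
  each below \<open>\<rho>\<close>.\<close>

lemma sparsified_row:
  fixes P :: "real ^ 'm::finite ^ 'n"
  assumes P: "P $ i \<in> prob_simplex" and \<rho>: "\<rho> \<ge> 0"
    and kept: "i \<noteq> istar \<Longrightarrow> kept_mass \<rho> P i \<noteq> 0"
  shows "sparsify \<rho> istar P $ i \<in> prob_simplex"
    and "l1_norm ((P - sparsify \<rho> istar P) $ i) \<le> 2 * (real CARD('m) * \<rho>)"
proof -
  define \<kappa> where "\<kappa> = kept_mass \<rho> P i"
  have nn: "\<And>j. 0 \<le> P $ i $ j" and s: "(\<Sum>j\<in>UNIV. P $ i $ j) = 1"
    using P by (auto simp: prob_simplex_def)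
  have dropped: "1 - \<kappa> = (\<Sum>j\<in>UNIV. P $ i $ j * of_bool (P $ i $ j < \<rho>))"
    unfolding s[symmetric] \<kappa>_def kept_mass_def sum_subtractf[symmetric]
    by (intro sum.cong) auto
  have \<kappa>0: "0 \<le> \<kappa>" unfolding \<kappa>_def kept_mass_def by (intro sum_nonneg) (auto simp: nn)
  have \<kappa>1: "0 \<le> 1 - \<kappa>" unfolding dropped by (intro sum_nonneg) (auto simp: nn)
  have "1 - \<kappa> \<le> (\<Sum>j\<in>(UNIV::'m set). \<rho>)"
    unfolding dropped by (intro sum_mono) (use \<rho> in auto)
  then have le: "1 - \<kappa> \<le> real CARD('m) * \<rho>" by simp
  show "sparsify \<rho> istar P $ i \<in> prob_simplex"
  proof (cases "i = istar")
    case True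
    then have "sparsify \<rho> istar P $ i = P $ i" by (simp add: sparsify_def vec_eq_iff)
    then show ?thesis using P by simp
  next
    case False
    then have "(\<Sum>j\<in>UNIV. sparsify \<rho> istar P $ i $ j) = \<kappa> / \<kappa>"
      by (simp add: sparsify_def sum_divide_distrib[symmetric] \<kappa>_def)
        (simp add: kept_mass_def)
    moreover have "0 \<le> sparsify \<rho> istar P $ i $ j" for j
      using False \<kappa>0 nn[of j] by (simp add: sparsify_def \<kappa>_def)
    ultimately show ?thesis using False kept by (simp add: prob_simplex_def \<kappa>_def)
  qed
  show "l1_norm ((P - sparsify \<rho> istar P) $ i) \<le> 2 * (real CARD('m) * \<rho>)"
  proof (cases "i = istar")
    case True
    then show ?thesis using \<rho> by (simp add: l1_norm_def sparsify_def)
  next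
    case False
    then have pos: "\<kappa> > 0" using kept \<kappa>0 by (simp add: \<kappa>_def)
    have "\<bar>P $ i $ j - P $ i $ j * of_bool (P $ i $ j \<ge> \<rho>) / \<kappa>\<bar>
        = P $ i $ j * of_bool (P $ i $ j < \<rho>)
          + (1 - \<kappa>) / \<kappa> * (P $ i $ j * of_bool (P $ i $ j \<ge> \<rho>))" for j
    proof (cases "P $ i $ j \<ge> \<rho>")
      case True
      have "P $ i $ j - P $ i $ j / \<kappa> = - ((1 - \<kappa>) / \<kappa> * P $ i $ j)"
        using pos by (simp add: field_simps)
      then show ?thesis
        using True pos \<kappa>1 nn[of j] by (simp add: abs_mult)
    qed (simp add: nn)
    then have "l1_norm ((P - sparsify \<rho> istar P) $ i)
        = (\<Sum>j\<in>UNIV. P $ i $ j * of_bool (P $ i $ j < \<rho>)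
            + (1 - \<kappa>) / \<kappa> * (P $ i $ j * of_bool (P $ i $ j \<ge> \<rho>)))"
      using False by (simp add: l1_norm_def sparsify_def flip: \<kappa>_def)
    also have "\<dots> = (1 - \<kappa>) + (1 - \<kappa>) / \<kappa> * \<kappa>"
      unfolding sum.distrib sum_distrib_left[symmetric] dropped[symmetric]
      by (simp add: \<kappa>_def kept_mass_def)
    also have "\<dots> = 2 * (1 - \<kappa>)" using pos by simp
    finally show ?thesis using le by simp
  qed
qed

lemma norm_blocks: "L2_set (\<lambda>k. norm (vec_block x k)) UNIV = norm x"
  by (simp add: norm_eq_sqrt_inner inner_blocks[of x x] L2_set_def)

lemma sum_norm_blocks_le:
  "(\<Sum>k\<in>UNIV. norm (vec_block y k) * norm (vec_block x k)) \<le> norm y * norm x"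
  using L2_set_mult_ineq[of "\<lambda>k. norm (vec_block y k)" "\<lambda>k. norm (vec_block x k)" UNIV]
  by (simp add: norm_blocks)

text \<open>By Cauchy-Schwarz, since the sum of the \<open>w_k\<^sup>2\<close> is at most \<open>W\<close> times the sum of the
  \<open>w_k\<close>. The square root lets a product of two such sums scale with \<open>W\<close>.\<close>

lemma weighted_norm_blocks_le:
  assumes w: "\<And>k. w k \<ge> 0" "(\<Sum>k\<in>UNIV. w k) = 1" and W: "\<And>k. w k \<le> W"
  shows "(\<Sum>k\<in>UNIV. w k * norm (vec_block x k)) \<le> sqrt W * norm x"
proof -
  have W0: "0 \<le> W" using w(1) W by (meson order_trans)
  have "(\<Sum>k\<in>UNIV. (w k)\<^sup>2) \<le> (\<Sum>k\<in>UNIV. W * w k)"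
    unfolding power2_eq_square by (intro sum_mono mult_right_mono W w)
  then have "L2_set w UNIV \<le> sqrt W"
    by (simp add: L2_set_def w(2) flip: sum_distrib_left)
  then have "L2_set w UNIV * norm x \<le> sqrt W * norm x"
    by (rule mult_right_mono) simp
  then show ?thesis
    using L2_set_mult_ineq[of w "\<lambda>k. norm (vec_block x k)" UNIV] w(1)
    by (simp add: norm_blocks)
qed

lemma abs_mixed_rows_le:
  assumes w: "\<And>k. w k \<ge> 0" "(\<Sum>k\<in>UNIV. w k) = 1" and W: "\<And>k. w k \<le> W"
    and Q: "\<And>k. l1_norm (Q k $ i) \<le> D"
  shows "\<bar>mixed_rows w Q x $ i\<bar> \<le> D * (sqrt W * norm x)"
proof -
  have D: "0 \<le> D" by (rule order_trans[OF l1_norm_nonneg Q])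
  have "\<bar>mixed_rows w Q x $ i\<bar> \<le> (\<Sum>k\<in>UNIV. w k * \<bar>Q k $ i \<bullet> vec_block x k\<bar>)"
    using sum_abs[of "\<lambda>k. w k * (Q k $ i \<bullet> vec_block x k)" UNIV] w(1)
    by (simp add: mixed_rows_def matrix_vector_nth abs_mult)
  also have "\<dots> \<le> (\<Sum>k\<in>UNIV. w k * (D * norm (vec_block x k)))"
    by (intro sum_mono mult_left_mono w order_trans[OF abs_inner_le_l1_norm] mult_right_mono Q) simp
  also have "\<dots> = D * (\<Sum>k\<in>UNIV. w k * norm (vec_block x k))"
    by (simp add: sum_distrib_left mult_ac)
  also have "\<dots> \<le> D * (sqrt W * norm x)"
    by (intro mult_left_mono weighted_norm_blocks_le D w W)
  finally show ?thesis .
qed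

lemma mixed_rows_diff: "mixed_rows w Q x - mixed_rows w Q' x = mixed_rows w (\<lambda>k. Q k - Q' k) x"
  by (simp add: mixed_rows_def matrix_vector_mult_diff_rdistrib scaleR_diff_right sum_subtractf)

text \<open>The row means change in one argument of \<open>Cov_v\<close> at a time, each time by at most
  \<open>2DW\<close>, relative to the norms of \<open>y\<close> and \<open>x\<close>; the 2 is the price of bounding the two
  parts of a covariance separately. The sum over covariances within rows changes by at most
  \<open>3DW\<close>, rounded up to
  \<open>4DW\<close> so that \<open>1/\<tau>\<close> and \<open>1/\<eta>\<close> share their constant.\<close>

lemma cov_form_perturb:
  assumes \<eta>: "\<eta> > 0" and \<tau>: "\<tau> > 0" and v: "v \<in> prob_simplex"
    and w: "\<And>k. w k \<ge> 0" "(\<Sum>k\<in>UNIV. w k) = 1" and W: "\<And>k. w k \<le> W"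
    and Q: "\<And>k i. Q k $ i \<in> prob_simplex" and Q': "\<And>k i. Q' k $ i \<in> prob_simplex"
    and D: "\<And>k i. l1_norm ((Q k - Q' k) $ i) \<le> D"
  shows "\<bar>cov_form \<eta> \<tau> w v Q y x - cov_form \<eta> \<tau> w v Q' y x\<bar>
    \<le> 4 * D * W * (1 / \<tau> + 1 / \<eta>) * (norm y * norm x)"
proof -
  have W0: "0 \<le> W" using w(1) W by (meson order_trans)
  have D0: "0 \<le> D" by (rule order_trans[OF l1_norm_nonneg D])
  note bnd = abs_mixed_rows_le[where w = w and W = W, OF w W]
  define A where "A = weighted_cov v (mixed_rows w Q y) (mixed_rows w Q x)
      - weighted_cov v (mixed_rows w Q' y) (mixed_rows w Q' x)"
  define B where "B = (\<Sum>k\<in>UNIV. w k * (\<Sum>i\<in>UNIV. v $ i *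
      (weighted_cov (Q k $ i) (vec_block y k) (vec_block x k)
       - weighted_cov (Q' k $ i) (vec_block y k) (vec_block x k))))"
  have "A = weighted_cov v (mixed_rows w (\<lambda>k. Q k - Q' k) y) (mixed_rows w Q x)
      + weighted_cov v (mixed_rows w Q' y) (mixed_rows w (\<lambda>k. Q k - Q' k) x)"
    by (simp add: A_def mixed_rows_diff[symmetric] weighted_cov_diff_left weighted_cov_diff_right)
  moreover have "\<bar>weighted_cov v (mixed_rows w (\<lambda>k. Q k - Q' k) y) (mixed_rows w Q x)\<bar>
      \<le> 2 * (D * (sqrt W * norm y)) * (1 * (sqrt W * norm x))"
    by (intro abs_weighted_cov_le v bnd D) (simp add: l1_norm_prob_simplex Q)
  moreover have "\<bar>weighted_cov v (mixed_rows w Q' y) (mixed_rows w (\<lambda>k. Q k - Q' k) x)\<bar>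
      \<le> 2 * (1 * (sqrt W * norm y)) * (D * (sqrt W * norm x))"
    by (intro abs_weighted_cov_le v bnd D) (simp add: l1_norm_prob_simplex Q')
  moreover have "sqrt W * (sqrt W * t) = W * t" for t
    using W0 by (simp flip: mult.assoc)
  ultimately have A: "\<bar>A\<bar> \<le> 4 * D * W * (norm y * norm x)"
    by (simp add: mult_ac)
  have "\<bar>B\<bar> \<le> (\<Sum>k\<in>UNIV. W * (3 * D * (norm (vec_block y k) * norm (vec_block x k))))"
    unfolding B_def
  proof (intro order_trans[OF sum_abs] sum_mono)
    fix k
    have "\<bar>\<Sum>i\<in>UNIV. v $ i *
      (weighted_cov (Q k $ i) (vec_block y k) (vec_block x k)
       - weighted_cov (Q' k $ i) (vec_block y k) (vec_block x k))\<bar>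
      \<le> 3 * D * (norm (vec_block y k) * norm (vec_block x k))"
      using D[of k]
      by (intro abs_weighted_mean_le v order_trans[OF weighted_cov_perturb] Q Q' mult_right_mono)
        auto
    then show "\<bar>w k * (\<Sum>i\<in>UNIV. v $ i *
      (weighted_cov (Q k $ i) (vec_block y k) (vec_block x k)
       - weighted_cov (Q' k $ i) (vec_block y k) (vec_block x k)))\<bar>
      \<le> W * (3 * D * (norm (vec_block y k) * norm (vec_block x k)))"
      unfolding abs_mult using w W W0 by (intro mult_mono) auto
  qed
  also have "\<dots> = 3 * D * W * (\<Sum>k\<in>UNIV. norm (vec_block y k) * norm (vec_block x k))"
    by (simp add: sum_distrib_left mult_ac)
  also have "\<dots> \<le> 3 * D * W * (norm y * norm x)"
    by (intro mult_left_mono sum_norm_blocks_le) (use D0 W0 in auto)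
  also have "\<dots> \<le> 4 * D * W * (norm y * norm x)"
    using D0 W0 by (intro mult_right_mono) auto
  finally have B: "\<bar>B\<bar> \<le> 4 * D * W * (norm y * norm x)" .
  have "cov_form \<eta> \<tau> w v Q y x - cov_form \<eta> \<tau> w v Q' y x = A / \<tau> + B / \<eta>"
    by (simp add: cov_form_def A_def B_def diff_divide_distrib right_diff_distrib sum_subtractf)
  also have "\<bar>\<dots>\<bar> \<le> \<bar>A\<bar> / \<tau> + \<bar>B\<bar> / \<eta>"
    using \<tau> \<eta> abs_triangle_ineq[of "A / \<tau>" "B / \<eta>"] by simp
  also have "\<dots> \<le> 4 * D * W * (norm y * norm x) / \<tau> + 4 * D * W * (norm y * norm x) / \<eta>"
    using \<tau> \<eta> by (intro add_mono divide_right_mono A B) auto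
  finally show ?thesis by (simp add: algebra_simps)
qed

text \<open>Testing with \<open>y = M x\<close> turns the bilinear bound into a bound on the norm of \<open>M x\<close>.\<close>

lemma spectral_norm_le:
  assumes "\<And>y x. \<bar>y \<bullet> (M *v x)\<bar> \<le> B * (norm y * norm x)"
  shows "spectral_norm M \<le> B"
  unfolding spectral_norm_def
proof (rule onorm_le)
  fix x
  have "norm (M *v x) * norm (M *v x) \<le> norm (M *v x) * (B * norm x)"
    using assms[of "M *v x" x] by (simp add: norm_eq_sqrt_inner mult_ac)
  (* A unit test vector shows that the bound is nonnegative; needed when M x = 0. *)
  moreover have "0 \<le> B * norm x"
    using assms[of "axis undefined 1" x] by (auto simp: norm_axis_1 intro: order_trans)
  ultimately show "norm (M *v x) \<le> B * norm x"
    by (cases "norm (M *v x) = 0") (auto dest: mult_left_le_imp_le)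
qed

theorem theorem4p2:
  fixes \<eta> \<tau> \<rho> :: real
    and w :: "'k::finite \<Rightarrow> real"
    and \<mu> :: "'k \<Rightarrow> real ^ 'm::finite"
    and C :: "'k \<Rightarrow> real ^ 'm ^ 'n::finite"
    and p :: "real ^ 'n"
    and \<beta> :: "real ^ ('k \<times> 'm)"
    and istar :: 'n
  assumes "\<eta> > 0" and "\<tau> > 0"
    and "\<And>k. \<mu> k \<in> prob_simplex"
    and "\<And>k i j. C k $ i $ j \<ge> 0"
    and "\<And>k. w k > 0" and "(\<Sum>k\<in>UNIV. w k) = 1"
    and "p \<in> prob_simplex"
    and "\<rho> \<ge> 0"
    and "is_arg_max (\<lambda>i. row_weights \<eta> \<tau> w \<mu> C p \<beta> $ i) (\<lambda>i. True) istar"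
    and "\<And>k i. i \<noteq> istar \<Longrightarrow>
           kept_mass \<rho> (plan \<eta> (\<mu> k) (C k) (vec_block \<beta> k)) i \<noteq> 0"
  shows "spectral_norm (hessian (objective \<eta> \<tau> w \<mu> C p) \<beta>
           - sparsified_hessian \<eta> \<tau> w \<mu> C p \<rho> istar \<beta>)
         \<le> 8 * real CARD('m) * real CARD('n) * \<rho> * Max (range w) * (1 / \<tau> + 1 / \<eta>)"
proof -
  define P where "P = (\<lambda>k. plan \<eta> (\<mu> k) (C k) (vec_block \<beta> k))"
  define R where "R = (\<lambda>k. sparsify \<rho> istar (P k))"
  define v where "v = row_weights \<eta> \<tau> w \<mu> C p \<beta>"
  define B where "B = 4 * (2 * (real CARD('m) * \<rho>)) * Max (range w) * (1 / \<tau> + 1 / \<eta>)"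
  have P: "P k $ i \<in> prob_simplex" for k i
    unfolding P_def plan_row by (rule softmax_in_prob_simplex[OF assms(3)])
  have v: "v \<in> prob_simplex"
    unfolding v_def row_weights_softmax by (rule softmax_in_prob_simplex[OF assms(7)])
  have W: "w k \<le> Max (range w)" for k by simp
  have R: "R k $ i \<in> prob_simplex"
    and D: "l1_norm ((P k - R k) $ i) \<le> 2 * (real CARD('m) * \<rho>)" for k i
    unfolding R_def
    using sparsified_row[OF P assms(8), where istar = istar] assms(10)
    by (auto simp: P_def)
  have "hessian (objective \<eta> \<tau> w \<mu> C p) \<beta> - sparsified_hessian \<eta> \<tau> w \<mu> C p \<rho> istar \<beta>
      = from_blocks (hessian_block \<eta> \<tau> w v P) - from_blocks (hessian_block \<eta> \<tau> w v R)"
    using hessian_objective[OF assms(1,2,3,7)]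
    by (simp add: sparsified_hessian_def P_def R_def v_def)
  also have "spectral_norm \<dots> \<le> B"
  proof (rule spectral_norm_le)
    fix y x
    show "\<bar>y \<bullet> ((from_blocks (hessian_block \<eta> \<tau> w v P) - from_blocks (hessian_block \<eta> \<tau> w v R)) *v x)\<bar>
        \<le> B * (norm y * norm x)"
      unfolding matrix_vector_mult_diff_rdistrib inner_diff_right inner_hessian_blocks B_def
      by (intro cov_form_perturb assms(1,2,6) v W P R D less_imp_le[OF assms(5)])
  qed
  (* The bound so far is free of n; it only grows with the factor n. *)
  also have "B = 1 * B" by simp
  also have "\<dots> \<le> real CARD('n) * B"
  proof (rule mult_right_mono)
    have "0 \<le> Max (range w)" using assms(5) W by (meson less_imp_le order_trans)
    then show "0 \<le> B" using assms(1,2,8) by (simp add: B_def)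
  qed (simp add: Suc_leI)
  finally show ?thesis by (simp add: B_def mult_ac)
qed

end
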